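(* Let $X$ be an ordered Banach space with non-normal cone. Assume that the space $X$ is reflexive or that, more generally, the bidual wedge $X''_+$ is a cone. Then there exists an increasing sequence in $X_+$ that converges weakly but not in norm.
   Context: An ordered Banach space is a real Banach space $X$ together with a norm closed cone $X_+$, i.e. a norm closed non-empty subset $X_+ \subseteq X$ with $\alpha X_+ + \beta X_+ \subseteq X_+$ for all scalars $\alpha,\beta \in [0,\infty)$ and $X_+ \cap (-X_+) = \{0\}$. The partial order is given by $x \le y$ iff $y - x \in X_+$. The cone $X_+$ is normal if there is a constant $C \ge 0$ such that $\|x\| \le C\|y\|$ for all $x,y \in X$ with $0 \le x \le y$; otherwise it is non-normal. The dual wedge is $X'_+ := \{x' \in X' : \langle x',x\rangle \ge 0 \text{ for all } x \in X_+\}$ and the bidual wedge is $X''_+ := \{x'' \in X'' : \langle x'',x'\rangle \ge 0 \text{ for all } x' \in X'_+\}$. The bidual wedge is called a cone (or pointed) if $X''_+ \cap (-X''_+) = \{0\}$. A sequence $(x_n)$ is increasing if $x_n \le x_m$ whenever $n \le m$. *)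

theory Defs
  imports "HOL-Analysis.Analysis"
begin

text \<open>
  The Banach space is the whole type; its order is given by a set \<open>P\<close>, the cone of positive
  elements, via \<open>x \<le> y\<close> iff \<open>y - x \<in> P\<close>. The dual and the bidual are the types
  \<open>'a \<Rightarrow>\<^sub>L real\<close> and \<open>('a \<Rightarrow>\<^sub>L real) \<Rightarrow>\<^sub>L real\<close>, with the operator norm.
\<close>

definition pointed :: "'a::ab_group_add set \<Rightarrow> bool" where
  "pointed W \<longleftrightarrow> W \<inter> uminus ` W = {0}"

definition ordered_banach_cone :: "'a::banach set \<Rightarrow> bool" where
  "ordered_banach_cone P \<longleftrightarrow>
     closed P \<and> P \<noteq> {} \<and>
     (\<forall>\<alpha>\<ge>0. \<forall>\<beta>\<ge>0. \<forall>x\<in>P. \<forall>y\<in>P. \<alpha> *\<^sub>R x + \<beta> *\<^sub>R y \<in> P) \<and>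
     pointed P"

definition cone_le :: "'a::ab_group_add set \<Rightarrow> 'a \<Rightarrow> 'a \<Rightarrow> bool" where
  "cone_le P x y \<longleftrightarrow> y - x \<in> P"

definition normal_cone :: "'a::real_normed_vector set \<Rightarrow> bool" where
  "normal_cone P \<longleftrightarrow>
     (\<exists>C\<ge>0. \<forall>x y. cone_le P 0 x \<and> cone_le P x y \<longrightarrow> norm x \<le> C * norm y)"

definition dual_wedge :: "'a::real_normed_vector set \<Rightarrow> ('a \<Rightarrow>\<^sub>L real) set" where
  "dual_wedge P = {f. \<forall>x\<in>P. 0 \<le> blinfun_apply f x}"

definition bidual_wedge ::
    "'a::real_normed_vector set \<Rightarrow> (('a \<Rightarrow>\<^sub>L real) \<Rightarrow>\<^sub>L real) set" where
  "bidual_wedge P = dual_wedge (dual_wedge P)"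

text \<open>The canonical embedding of a space into its bidual, \<open>x \<mapsto> (f \<mapsto> f x)\<close>.\<close>

definition bidual_embedding ::
    "'a::real_normed_vector \<Rightarrow> (('a \<Rightarrow>\<^sub>L real) \<Rightarrow>\<^sub>L real)" where
  "bidual_embedding x = Blinfun (\<lambda>f. blinfun_apply f x)"

text \<open>\<open>Blinfun\<close> is only meaningful on bounded linear maps, which evaluation at a point is.\<close>

lemma bidual_embedding_apply [simp]:
  "blinfun_apply (bidual_embedding x) f = blinfun_apply f x"
  unfolding bidual_embedding_def
  by (simp add: bounded_linear_Blinfun_apply blinfun.bounded_linear_left)

text \<open>The \<open>itself\<close> argument only serves to pass the space, which is a type.\<close>

definition reflexive_space :: "'a::real_normed_vector itself \<Rightarrow> bool" where
  "reflexive_space _ \<longleftrightarrow>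
     surj (bidual_embedding :: 'a \<Rightarrow> (('a \<Rightarrow>\<^sub>L real) \<Rightarrow>\<^sub>L real))"

definition increasing_seq :: "'a::ab_group_add set \<Rightarrow> (nat \<Rightarrow> 'a) \<Rightarrow> bool" where
  "increasing_seq P x \<longleftrightarrow> (\<forall>n m. n \<le> m \<longrightarrow> cone_le P (x n) (x m))"

definition weakly_convergent :: "(nat \<Rightarrow> 'a::real_normed_vector) \<Rightarrow> bool" where
  "weakly_convergent x \<longleftrightarrow>
     (\<exists>l. \<forall>f :: 'a \<Rightarrow>\<^sub>L real.
        (\<lambda>n. blinfun_apply f (x n)) \<longlonglongrightarrow> blinfun_apply f l)"

end

theory Submission
  imports Defs
begin

text \<open>
  Because the cone is not normal, there are \<open>0 \<le> x\<^sub>n \<le> y\<^sub>n\<close> with \<open>norm x\<^sub>n = 1\<close> and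
  \<open>norm y\<^sub>n < 2 ^ -n\<close>. Put \<open>s\<^sub>n = y\<^sub>0 + \<dots> + y\<^bsub>n-1\<^esub> + x\<^sub>n\<close>.
  Each \<open>s\<^sub>n\<close> is positive, and the sequence is increasing, since
  \<open>s\<^bsub>n+1\<^esub> - s\<^sub>n = (y\<^sub>n - x\<^sub>n) + x\<^bsub>n+1\<^esub>\<close>. The sums of the \<open>y\<^sub>k\<close> converge in norm, so \<open>s\<close>
  converges, weakly or in norm, exactly if \<open>x\<close> does. Every positive functional \<open>f\<close> satisfies
  \<open>0 \<le> f x\<^sub>n \<le> f y\<^sub>n\<close>, so \<open>f x\<^sub>n\<close> tends to 0. This extends to the span of the dual wedge and, as
  \<open>x\<close> is bounded, to the norm closure of that span, which is the whole dual space if the bidual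
  wedge is pointed (lemma \<open>pointed_bidual_wedge_imp_dense\<close>). Thus \<open>x\<close> converges weakly to 0, but
  not in norm, because \<open>norm x\<^sub>n = 1\<close>.

  In a reflexive space the bidual wedge is always pointed
  (lemma \<open>reflexive_imp_pointed_bidual_wedge\<close>). This and the density statement rest on the
  separation of a point from a closed wedge (lemma \<open>closed_wedge_separation\<close>), which follows from
  the Hahn-Banach theorem for sublinear functionals (lemma \<open>linear_below_sublinear_eq_at\<close>).
\<close>

section \<open>Sublinear functionals\<close>

text \<open>
  A sublinear functional on a real vector space. One inequality for positive scalars suffices:
  the reverse one follows by rescaling, and \<open>q 0 = 0\<close> is a consequence.
\<close>

definition sublinear :: "('a::real_vector \<Rightarrow> real) \<Rightarrow> bool" where
  "sublinear q \<longleftrightarrow>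
     (\<forall>x y. q (x + y) \<le> q x + q y) \<and> (\<forall>c>0. \<forall>x. q (c *\<^sub>R x) \<le> c * q x)"

lemma sublinearI:
  assumes "\<And>x y. q (x + y) \<le> q x + q y" "\<And>c x. c > 0 \<Longrightarrow> q (c *\<^sub>R x) \<le> c * q x"
  shows "sublinear q"
  using assms unfolding sublinear_def by blast

lemma sublinear_add: "sublinear q \<Longrightarrow> q (x + y) \<le> q x + q y"
  unfolding sublinear_def by blast

lemma sublinear_scale_le: "sublinear q \<Longrightarrow> c > 0 \<Longrightarrow> q (c *\<^sub>R x) \<le> c * q x"
  unfolding sublinear_def by blast

lemma sublinear_zero:
  assumes "sublinear q"
  shows "q 0 = 0"
  using sublinear_add[OF assms, of 0 0] sublinear_scale_le[OF assms, of "1/2" 0] by simp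

lemma sublinear_scale:
  assumes "sublinear q" "c \<ge> 0"
  shows "q (c *\<^sub>R x) = c * q x"
proof (cases "c = 0")
  case True
  then show ?thesis using sublinear_zero[OF assms(1)] by simp
next
  case False
  then have c: "c > 0" using assms(2) by simp
  have "q x \<le> inverse c * q (c *\<^sub>R x)"
    using sublinear_scale_le[OF assms(1), of "inverse c" "c *\<^sub>R x"] c by simp
  then have "c * q x \<le> q (c *\<^sub>R x)"
    using c by (simp add: field_simps)
  then show ?thesis
    using sublinear_scale_le[OF assms(1) c, of x] by simp
qed

lemma sublinear_ge_neg:
  assumes "sublinear q"
  shows "- q (- x) \<le> q x"
  using sublinear_add[OF assms, of x "- x"] sublinear_zero[OF assms] by simp

lemma additive_sublinear_imp_linear:
  assumes q: "sublinear q" and add: "\<And>x y. q (x + y) = q x + q y"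
  shows "linear q"
proof (rule linearI)
  show "q (x + y) = q x + q y" for x y by (rule add)
  have minus: "q (- x) = - q x" for x
    using add[of x "- x"] sublinear_zero[OF q] by simp
  show "q (c *\<^sub>R x) = c *\<^sub>R q x" for c x
  proof (cases "c \<ge> 0")
    case True
    then show ?thesis using sublinear_scale[OF q] by simp
  next
    case False
    then show ?thesis
      using sublinear_scale[OF q, of "- c" x] minus[of "c *\<^sub>R x"] by simp
  qed
qed

text \<open>
  For sublinear \<open>q\<close>, the largest sublinear functional below \<open>q\<close> whose value at \<open>- a\<close> is at
  most \<open>- q a\<close>, so that it is forced to be additive along the line through \<open>a\<close>.
\<close>

definition lower_along :: "('a::real_vector \<Rightarrow> real) \<Rightarrow> 'a \<Rightarrow> 'a \<Rightarrow> real" where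
  "lower_along q a x = (INF t\<in>{0..}. q (x + t *\<^sub>R a) - t * q a)"

lemma
  assumes q: "sublinear q"
  shows lower_along_le: "\<And>t x. t \<ge> 0 \<Longrightarrow> lower_along q a x \<le> q (x + t *\<^sub>R a) - t * q a"
    and sublinear_lower_along: "sublinear (lower_along q a)"
proof -
  have bdd: "bdd_below ((\<lambda>t. q (x + t *\<^sub>R a) - t * q a) ` {0..})" for x
  proof (rule bdd_belowI2)
    fix t :: real assume "t \<in> {0..}"
    then have "t * q a = q (t *\<^sub>R a)"
      using sublinear_scale[OF q] by simp
    also have "\<dots> = q ((x + t *\<^sub>R a) + (- x))" by simp
    also have "\<dots> \<le> q (x + t *\<^sub>R a) + q (- x)" by (rule sublinear_add[OF q])
    finally show "- q (- x) \<le> q (x + t *\<^sub>R a) - t * q a" by simp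
  qed
  show le: "lower_along q a x \<le> q (x + t *\<^sub>R a) - t * q a" if "t \<ge> 0" for t x
    unfolding lower_along_def using that by (intro cINF_lower bdd) simp
  show "sublinear (lower_along q a)"
  proof (rule sublinearI)
    fix x y
    have "lower_along q a (x + y) - (q (y + t *\<^sub>R a) - t * q a) \<le> lower_along q a x"
      if t: "t \<ge> 0" for t
      unfolding lower_along_def[of q a x]
    proof (rule cINF_greatest)
      fix s :: real assume "s \<in> {0..}"
      then have "lower_along q a (x + y) \<le> q ((x + y) + (s + t) *\<^sub>R a) - (s + t) * q a"
        using t by (intro le) simp
      also have "(x + y) + (s + t) *\<^sub>R a = (x + s *\<^sub>R a) + (y + t *\<^sub>R a)"
        by (simp add: algebra_simps)
      also have "q \<dots> - (s + t) * q a \<le> q (x + s *\<^sub>R a) + q (y + t *\<^sub>R a) - (s + t) * q a"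
        using sublinear_add[OF q] by simp
      finally show "lower_along q a (x + y) - (q (y + t *\<^sub>R a) - t * q a)
          \<le> q (x + s *\<^sub>R a) - s * q a"
        by (simp add: algebra_simps)
    qed simp
    then have "lower_along q a (x + y) - lower_along q a x \<le> lower_along q a y"
      unfolding lower_along_def[of q a y]
      by (intro cINF_greatest) (auto simp: algebra_simps)
    then show "lower_along q a (x + y) \<le> lower_along q a x + lower_along q a y" by simp
  next
    fix c :: real and x assume c: "c > 0"
    have "inverse c * lower_along q a (c *\<^sub>R x) \<le> lower_along q a x"
      unfolding lower_along_def[of q a x]
    proof (rule cINF_greatest)
      fix t :: real assume "t \<in> {0..}"
      then have "lower_along q a (c *\<^sub>R x) \<le> q (c *\<^sub>R x + (c * t) *\<^sub>R a) - (c * t) * q a"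
        using c by (intro le) simp
      also have "c *\<^sub>R x + (c * t) *\<^sub>R a = c *\<^sub>R (x + t *\<^sub>R a)"
        by (simp add: algebra_simps)
      also have "q \<dots> - (c * t) * q a = c * (q (x + t *\<^sub>R a) - t * q a)"
        using sublinear_scale[OF q, of c] c by (simp add: right_diff_distrib)
      finally show "inverse c * lower_along q a (c *\<^sub>R x) \<le> q (x + t *\<^sub>R a) - t * q a"
        using c by (simp add: field_simps)
    qed simp
    then show "lower_along q a (c *\<^sub>R x) \<le> c * lower_along q a x"
      using c by (simp add: field_simps)
  qed
qed

lemma sublinear_chain_INF:
  assumes C: "C \<noteq> {}" and sub: "\<And>q. q \<in> C \<Longrightarrow> sublinear q"
    and chain: "\<And>q r. q \<in> C \<Longrightarrow> r \<in> C \<Longrightarrow> q \<le> r \<or> r \<le> q"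
    and bdd: "\<And>x. bdd_below ((\<lambda>q. q x) ` C)"
  shows "sublinear (\<lambda>x. INF q\<in>C. q x)"
proof (rule sublinearI)
  let ?r = "\<lambda>x. INF q\<in>C. q x"
  have le: "?r x \<le> q x" if "q \<in> C" for q x
    using that by (intro cINF_lower bdd)
  show "?r (x + y) \<le> ?r x + ?r y" for x y
  proof -
    have *: "?r (x + y) \<le> q x + r y" if qr: "q \<in> C" "r \<in> C" for q r
    proof -
      obtain s where s: "s \<in> C" "s \<le> q" "s \<le> r"
        using chain[OF qr] qr by blast
      have "?r (x + y) \<le> s (x + y)" by (rule le[OF s(1)])
      also have "\<dots> \<le> s x + s y" by (rule sublinear_add[OF sub[OF s(1)]])
      also have "\<dots> \<le> q x + r y"
        using s(2,3) by (intro add_mono) (auto simp: le_fun_def)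
      finally show ?thesis .
    qed
    have "?r (x + y) - r y \<le> ?r x" if "r \<in> C" for r
      using *[OF _ that] by (intro cINF_greatest C) (auto simp: algebra_simps)
    then have "?r (x + y) - ?r x \<le> ?r y"
      by (intro cINF_greatest C) (auto simp: algebra_simps)
    then show ?thesis by simp
  qed
  show "?r (c *\<^sub>R x) \<le> c * ?r x" if c: "c > 0" for c x
  proof -
    have "?r (c *\<^sub>R x) / c \<le> q x" if "q \<in> C" for q
      using le[OF that, of "c *\<^sub>R x"] sublinear_scale[OF sub[OF that], of c x] c
      by (simp add: field_simps)
    then have "?r (c *\<^sub>R x) / c \<le> ?r x"
      by (intro cINF_greatest C)
    then show ?thesis using c by (simp add: field_simps)
  qed
qed

section \<open>The Hahn-Banach theorem and separation from a closed wedge\<close>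

text \<open>
  By Zorn's lemma there is a minimal sublinear functional below \<open>p\<close>. Such a functional \<open>q\<close>
  is not changed by passing to \<open>lower_along q a\<close>, which makes it additive.
\<close>

lemma linear_below_sublinear:
  assumes p: "sublinear p"
  shows "\<exists>f. linear f \<and> (\<forall>x. f x \<le> p x)"
proof -
  define A where "A = {q. sublinear q \<and> q \<le> p}"
  have pA: "p \<in> A" using p by (simp add: A_def)
  \<comment> \<open>Zorn's lemma is applied to the reversed order, so that it yields a minimal element.\<close>
  have "\<exists>m\<in>A. \<forall>q\<in>A. m \<ge> q \<longrightarrow> q = m"
  proof (rule predicate_Zorn[where P = "\<lambda>x y. x \<ge> y"])
    show "partial_order_on A (relation_of (\<lambda>x y. x \<ge> y) A)"
      by (rule partial_order_on_relation_ofI) auto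
    fix C assume "C \<in> Chains (relation_of (\<lambda>x y. x \<ge> y) A)"
    then have CA: "C \<subseteq> A" and chain: "\<And>q r. q \<in> C \<Longrightarrow> r \<in> C \<Longrightarrow> q \<le> r \<or> r \<le> q"
      unfolding Chains_def relation_of_def by blast+
    show "\<exists>u\<in>A. \<forall>q\<in>C. u \<le> q"
    proof (cases "C = {}")
      case True
      then show ?thesis using pA by blast
    next
      case False
      \<comment> \<open>The infimum of a chain is finite because all members dominate \<open>x \<mapsto> - p (- x)\<close>.\<close>
      have bdd: "bdd_below ((\<lambda>q. q x) ` C)" for x
      proof (rule bdd_belowI2)
        fix q assume "q \<in> C"
        then have q: "sublinear q" "q \<le> p" using CA by (auto simp: A_def)
        then show "- p (- x) \<le> q x"
          using sublinear_ge_neg[OF q(1), of x] by (smt (verit) le_funD)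
      qed
      let ?r = "\<lambda>x. INF q\<in>C. q x"
      have le: "?r \<le> q" if "q \<in> C" for q
        using that by (intro le_funI cINF_lower bdd)
      obtain q where "q \<in> C" using False by blast
      then have "?r \<le> p" using le CA by (force simp: A_def intro: order_trans)
      moreover have "sublinear ?r"
        using False CA chain bdd by (intro sublinear_chain_INF) (auto simp: A_def)
      ultimately show ?thesis using le by (auto simp: A_def)
    qed
  qed
  then obtain m where m: "sublinear m" "m \<le> p"
    and min: "\<And>q. sublinear q \<Longrightarrow> q \<le> m \<Longrightarrow> q = m"
    unfolding A_def by (blast intro: order_trans)
  have "m (x + a) = m x + m a" for x a
  proof (rule antisym)
    show "m (x + a) \<le> m x + m a" by (rule sublinear_add[OF m(1)])
    have "lower_along m a \<le> m"
      using lower_along_le[OF m(1), of 0 a] by (auto simp: le_fun_def)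
    then have "lower_along m a = m"
      by (intro min sublinear_lower_along m(1))
    then show "m x + m a \<le> m (x + a)"
      using lower_along_le[OF m(1), of 1 a x] by simp
  qed
  then have "linear m" by (rule additive_sublinear_imp_linear[OF m(1)])
  then show ?thesis using m(2) by (auto simp: le_fun_def)
qed

text \<open>
  Equality at \<open>a\<close> comes from choosing the linear functional below \<open>lower_along p a\<close>, whose value at
  \<open>- a\<close> is at most \<open>- p a\<close>.
\<close>

lemma linear_below_sublinear_eq_at:
  assumes p: "sublinear p"
  shows "\<exists>f. linear f \<and> (\<forall>x. f x \<le> p x) \<and> f a = p a"
proof -
  obtain f where f: "linear f" "\<And>x. f x \<le> lower_along p a x"
    using linear_below_sublinear[OF sublinear_lower_along[OF p]] by blast
  have fp: "f x \<le> p x" for x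
    using f(2)[of x] lower_along_le[OF p, of 0 a x] by simp
  have "f (- a) \<le> - p a"
    using f(2)[of "- a"] lower_along_le[OF p, of 1 a "- a"] sublinear_zero[OF p] by simp
  then have "p a \<le> f a" using linear_neg[OF f(1)] by simp
  then have "f a = p a" using fp[of a] by simp
  then show ?thesis using f(1) fp by blast
qed

text \<open>
  The separating functional is dominated by the distance \<open>x \<mapsto> infdist (- x) W\<close> to \<open>- W\<close>,
  which is sublinear, vanishes on \<open>- W\<close>, and is bounded by the norm.
\<close>

lemma closed_wedge_separation:
  fixes W :: "'a::real_normed_vector set"
  assumes W: "closed W" "0 \<in> W" "\<And>x y. x \<in> W \<Longrightarrow> y \<in> W \<Longrightarrow> x + y \<in> W"
    "\<And>c x. c \<ge> 0 \<Longrightarrow> x \<in> W \<Longrightarrow> c *\<^sub>R x \<in> W"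
    and a: "a \<notin> W"
  shows "\<exists>f\<in>dual_wedge W. blinfun_apply f a < 0"
proof -
  define p where "p = (\<lambda>x. infdist (- x) W)"
  have ne: "W \<noteq> {}" using W(2) by blast
  have le: "p x \<le> norm (x + w)" if "w \<in> W" for x w
    using infdist_le[OF that, of "- x"] unfolding p_def dist_norm
    by (metis norm_minus_cancel minus_add_distrib uminus_add_conv_diff add_uminus_conv_diff)
  have ge: "u \<le> p x" if "\<And>w. w \<in> W \<Longrightarrow> u \<le> norm (x + w)" for u x
    unfolding p_def infdist_notempty[OF ne]
  proof (rule cINF_greatest[OF ne])
    fix w assume "w \<in> W"
    have "dist (- x) w = norm (x + w)"
      unfolding dist_norm by (metis norm_minus_cancel minus_diff_eq diff_minus_eq_add add.commute)
    then show "u \<le> dist (- x) w" using that[OF \<open>w \<in> W\<close>] by simp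
  qed
  have "sublinear p"
  proof (rule sublinearI)
    fix x y
    have "p (x + y) \<le> norm (x + v) + norm (y + w)" if vw: "v \<in> W" "w \<in> W" for v w
    proof -
      have "p (x + y) \<le> norm ((x + y) + (v + w))" by (intro le W(3) vw)
      also have "(x + y) + (v + w) = (x + v) + (y + w)" by (simp add: algebra_simps)
      also have "norm \<dots> \<le> norm (x + v) + norm (y + w)" by (rule norm_triangle_ineq)
      finally show ?thesis .
    qed
    then have "p (x + y) - norm (y + w) \<le> p x" if "w \<in> W" for w
      using that by (intro ge) (simp add: algebra_simps)
    then have "p (x + y) - p x \<le> p y"
      by (intro ge) (simp add: algebra_simps)
    then show "p (x + y) \<le> p x + p y" by simp
  next
    fix c :: real and x assume c: "c > 0"
    have "p (c *\<^sub>R x) / c \<le> p x"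
    proof (rule ge)
      fix w assume "w \<in> W"
      then have "p (c *\<^sub>R x) \<le> norm (c *\<^sub>R x + c *\<^sub>R w)"
        using c by (intro le W(4)) auto
      also have "\<dots> = c * norm (x + w)"
        using c by (simp flip: scaleR_add_right)
      finally show "p (c *\<^sub>R x) / c \<le> norm (x + w)"
        using c by (simp add: field_simps)
    qed
    then show "p (c *\<^sub>R x) \<le> c * p x" using c by (simp add: field_simps)
  qed
  then obtain f where f: "linear f" "\<And>x. f x \<le> p x" "f (- a) = p (- a)"
    using linear_below_sublinear_eq_at[of p "- a"] by blast
  have "f x \<le> norm x" for x
    using f(2)[of x] le[OF W(2), of x] by simp
  from this this[of "- x" for x] have bound: "norm (f x) \<le> norm x" for x
    using linear_neg[OF f(1)] by (simp add: abs_le_iff)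
  have "bounded_linear f"
    using f(1) bound by (intro bounded_linear_intro[where K = 1])
      (auto simp: linear_add linear_scale)
  then have F: "blinfun_apply (Blinfun f) = f" by (rule bounded_linear_Blinfun_apply)
  have "0 \<le> f w" if "w \<in> W" for w
    using f(2)[of "- w"] le[OF that, of "- w"] linear_neg[OF f(1), of w] by simp
  moreover have "f a < 0"
  proof -
    have "p (- a) > 0"
      using in_closed_iff_infdist_zero[OF W(1) ne, of a] a infdist_nonneg[of a W]
      unfolding p_def by (simp add: less_le)
    then show ?thesis using f(3) linear_neg[OF f(1), of a] by simp
  qed
  ultimately show ?thesis
    using F by (intro bexI[of _ "Blinfun f"]) (auto simp: dual_wedge_def)
qed

section \<open>The dual and bidual wedges\<close>

lemma ordered_banach_coneD:
  assumes "ordered_banach_cone P"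
  shows "closed P" "0 \<in> P" "\<And>x y. x \<in> P \<Longrightarrow> y \<in> P \<Longrightarrow> x + y \<in> P"
    "\<And>c x. c \<ge> 0 \<Longrightarrow> x \<in> P \<Longrightarrow> c *\<^sub>R x \<in> P" "pointed P"
proof -
  have comb: "\<alpha> *\<^sub>R x + \<beta> *\<^sub>R y \<in> P" if "\<alpha> \<ge> 0" "\<beta> \<ge> 0" "x \<in> P" "y \<in> P" for \<alpha> \<beta> x y
    using assms that unfolding ordered_banach_cone_def by blast
  show "closed P" "pointed P" using assms unfolding ordered_banach_cone_def by auto
  then show "0 \<in> P" unfolding pointed_def by blast
  show "x + y \<in> P" if "x \<in> P" "y \<in> P" for x y using comb[of 1 1 x y] that by simp
  show "c *\<^sub>R x \<in> P" if "c \<ge> 0" "x \<in> P" for c x using comb[of c 0 x x] that by simp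
qed

text \<open>
  In a reflexive space the bidual wedge is the image of the cone itself, since a closed wedge
  is determined by the positive functionals.
\<close>

lemma reflexive_imp_pointed_bidual_wedge:
  fixes P :: "'a::banach set"
  assumes P: "ordered_banach_cone P" and refl: "reflexive_space TYPE('a)"
  shows "pointed (bidual_wedge P)"
proof -
  note cone = ordered_banach_coneD[OF P]
  have mem: "x \<in> P" if "bidual_embedding x \<in> bidual_wedge P" for x :: 'a
  proof (rule ccontr)
    assume "x \<notin> P"
    then obtain f where "f \<in> dual_wedge P" "blinfun_apply f x < 0"
      using closed_wedge_separation[OF cone(1-4)] by blast
    moreover from this(1) that have "0 \<le> blinfun_apply f x"
      unfolding bidual_wedge_def dual_wedge_def[of "dual_wedge P"] by fastforce
    ultimately show False by simp
  qed
  have emb_neg: "- bidual_embedding x = bidual_embedding (- x)" for x :: 'a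
    by (rule blinfun_eqI) (simp add: blinfun.minus_left blinfun.minus_right)
  have "\<phi> = 0" if "\<phi> \<in> bidual_wedge P" "- \<phi> \<in> bidual_wedge P" for \<phi>
  proof -
    obtain x where x: "\<phi> = bidual_embedding x"
      using refl unfolding reflexive_space_def by (meson surjD)
    then have "x \<in> P" "- x \<in> P" using that mem emb_neg by metis+
    then have "x \<in> P \<inter> uminus ` P" by (metis IntI image_eqI minus_minus)
    then have "x = 0" using cone(5) unfolding pointed_def by blast
    then show ?thesis unfolding x by (intro blinfun_eqI) simp
  qed
  moreover have "0 \<in> bidual_wedge P"
    unfolding bidual_wedge_def dual_wedge_def[of "dual_wedge P"] by simp
  ultimately show ?thesis unfolding pointed_def by force
qed

lemma subspace_closure:
  fixes S :: "'a::real_normed_vector set"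
  assumes "subspace S"
  shows "subspace (closure S)"
proof (rule subspaceI)
  show "0 \<in> closure S"
    using subspace_0[OF assms] closure_subset by blast
  show "x + y \<in> closure S" if xy: "x \<in> closure S" "y \<in> closure S" for x y
  proof -
    obtain u v where uv: "\<And>n. u n \<in> S" "u \<longlonglongrightarrow> x" "\<And>n. v n \<in> S" "v \<longlonglongrightarrow> y"
      using xy unfolding closure_sequential by blast
    then have "(\<lambda>n. u n + v n) \<longlonglongrightarrow> x + y" "\<And>n. u n + v n \<in> S"
      using assms by (auto intro: tendsto_add subspace_add)
    then show ?thesis
      unfolding closure_sequential by (intro exI[of _ "\<lambda>n. u n + v n"]) simp
  qed
  show "c *\<^sub>R x \<in> closure S" if x: "x \<in> closure S" for c x
  proof -
    obtain u where u: "\<And>n. u n \<in> S" "u \<longlonglongrightarrow> x"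
      using x unfolding closure_sequential by blast
    then have "(\<lambda>n. c *\<^sub>R u n) \<longlonglongrightarrow> c *\<^sub>R x" "\<And>n. c *\<^sub>R u n \<in> S"
      using assms by (auto intro: tendsto_scaleR subspace_scale)
    then show ?thesis
      unfolding closure_sequential by (intro exI[of _ "\<lambda>n. c *\<^sub>R u n"]) simp
  qed
qed

text \<open>
  A functional separating a point from the closure of the span of the dual wedge vanishes on the
  dual wedge, hence lies in the bidual wedge together with its negative.
\<close>

lemma pointed_bidual_wedge_imp_dense:
  fixes P :: "'a::real_normed_vector set"
  assumes "pointed (bidual_wedge P)"
  shows "closure (span (dual_wedge P)) = UNIV"
proof (rule ccontr)
  let ?W = "closure (span (dual_wedge P))"
  have W: "subspace ?W" by (intro subspace_closure subspace_span)
  assume "?W \<noteq> UNIV"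
  then obtain a where "a \<notin> ?W" by blast
  then obtain \<phi> where \<phi>: "\<phi> \<in> dual_wedge ?W" "blinfun_apply \<phi> a < 0"
    using closed_wedge_separation[of ?W a] W
    by (auto simp: subspace_0 subspace_add subspace_scale)
  have sub: "f \<in> ?W" "- f \<in> ?W" if "f \<in> dual_wedge P" for f
    using that W by (auto intro: closure_subset[THEN subsetD] span_base subspace_neg)
  have "\<phi> \<in> bidual_wedge P" "- \<phi> \<in> bidual_wedge P"
    using \<phi>(1) sub unfolding bidual_wedge_def dual_wedge_def[of ?W] dual_wedge_def[of "dual_wedge P"]
    by (fastforce simp: blinfun.minus_left blinfun.minus_right)+
  then have "\<phi> \<in> bidual_wedge P \<inter> uminus ` bidual_wedge P"
    by (metis IntI image_eqI minus_minus)
  then have "\<phi> = 0" using assms unfolding pointed_def by blast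
  then show False using \<phi>(2) by simp
qed

section \<open>The increasing sequence\<close>

lemma bounded_weakly_null_if_dense:
  fixes x :: "nat \<Rightarrow> 'a::real_normed_vector"
  assumes bdd: "\<And>n. norm (x n) \<le> K" and dense: "closure D = UNIV"
    and D: "\<And>f :: 'a \<Rightarrow>\<^sub>L real. f \<in> D \<Longrightarrow> (\<lambda>n. blinfun_apply f (x n)) \<longlonglongrightarrow> 0"
  shows "(\<lambda>n. blinfun_apply (f :: 'a \<Rightarrow>\<^sub>L real) (x n)) \<longlonglongrightarrow> 0"
proof (rule LIMSEQ_I)
  fix e :: real assume e: "e > 0"
  have K: "K \<ge> 0" using bdd[of 0] norm_ge_zero order_trans by blast
  define d where "d = e / (2 * (K + 1))"
  have d: "d > 0" using e K by (simp add: d_def)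
  have "f \<in> closure D" using dense by simp
  then obtain g where g: "g \<in> D" "dist g f < d"
    using d unfolding closure_approachable by blast
  obtain N where N: "\<And>n. n \<ge> N \<Longrightarrow> norm (blinfun_apply g (x n)) < e / 2"
    using LIMSEQ_D[OF D[OF g(1)], of "e / 2"] e by auto
  have "norm (blinfun_apply f (x n)) < e" if "n \<ge> N" for n
  proof -
    have "norm (blinfun_apply (f - g) (x n)) \<le> norm (f - g) * norm (x n)"
      by (rule norm_blinfun)
    also have "\<dots> \<le> d * K"
      using g(2) bdd[of n] d by (intro mult_mono) (auto simp: dist_norm norm_minus_commute)
    also have "\<dots> \<le> e / 2" using e K by (simp add: d_def field_simps)
    finally have "norm (blinfun_apply (f - g) (x n)) \<le> e / 2" .
    then show ?thesis
      using N[OF that] by (simp add: blinfun.diff_left abs_if split: if_splits)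
  qed
  then show "\<exists>N. \<forall>n\<ge>N. norm (blinfun_apply f (x n) - 0) < e" by auto
qed

lemma non_normal_normalized:
  fixes P :: "'a::real_normed_vector set"
  assumes "\<not> normal_cone P" and scale: "\<And>c x. c \<ge> 0 \<Longrightarrow> x \<in> P \<Longrightarrow> c *\<^sub>R x \<in> P"
    and C: "C > 0"
  shows "\<exists>x y. x \<in> P \<and> y - x \<in> P \<and> norm x = 1 \<and> norm y < 1 / C"
proof -
  obtain x y where xy: "x \<in> P" "y - x \<in> P" "norm x > C * norm y"
    using assms(1) C unfolding normal_cone_def cone_le_def
    by (metis diff_zero less_imp_le not_le)
  moreover have "C * norm y \<ge> 0" using C by simp
  ultimately have pos: "norm x > 0" by linarith
  let ?c = "inverse (norm x)"
  have "?c *\<^sub>R x \<in> P" "?c *\<^sub>R y - ?c *\<^sub>R x \<in> P"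
    using scale[of ?c x] scale[of ?c "y - x"] xy pos by (simp_all add: scaleR_diff_right)
  moreover have "norm (?c *\<^sub>R x) = 1" using pos by simp
  moreover have "norm (?c *\<^sub>R y) < 1 / C"
    using pos C xy(3) by (simp add: field_simps)
  ultimately show ?thesis by blast
qed

theorem theorem6p3:
  fixes P :: "'a::banach set"
  assumes "ordered_banach_cone P"
    and "\<not> normal_cone P"
    and "reflexive_space TYPE('a) \<or> pointed (bidual_wedge P)"
  shows "\<exists>x :: nat \<Rightarrow> 'a. (\<forall>n. x n \<in> P) \<and> increasing_seq P x
           \<and> weakly_convergent x \<and> \<not> convergent x"
proof -
  note cone = ordered_banach_coneD[OF assms(1)]
  have dense: "closure (span (dual_wedge P)) = UNIV"
    using assms(3) reflexive_imp_pointed_bidual_wedge[OF assms(1)]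
    by (intro pointed_bidual_wedge_imp_dense) blast
  have "\<forall>n::nat. \<exists>x y. x \<in> P \<and> y - x \<in> P \<and> norm x = 1 \<and> norm y < 1 / 2 ^ n"
    using non_normal_normalized[OF assms(2) cone(4)] by simp
  then obtain x y :: "nat \<Rightarrow> 'a" where x: "\<And>n. x n \<in> P" and yx: "\<And>n. y n - x n \<in> P"
    and norm_x: "\<And>n. norm (x n) = 1" and norm_y: "\<And>n. norm (y n) < 1 / 2 ^ n"
    by metis
  have summable: "summable (\<lambda>n. norm (y n))"
    using norm_y by (intro summable_comparison_test'[OF summable_geometric[of "1/2"], of 0])
      (auto simp: power_one_over less_imp_le)
  define Y where "Y = (\<lambda>n. \<Sum>k<n. y k)"
  have Y: "Y \<longlonglongrightarrow> suminf y"
    unfolding Y_def by (rule summable_LIMSEQ[OF summable_norm_cancel[OF summable]])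
  have y0: "y \<longlonglongrightarrow> 0"
    by (rule summable_LIMSEQ_zero[OF summable_norm_cancel[OF summable]])

  have pos: "(\<lambda>n. blinfun_apply f (x n)) \<longlonglongrightarrow> 0" if "f \<in> dual_wedge P" for f
  proof (rule tendsto_sandwich[OF _ _ tendsto_const])
    show "\<forall>\<^sub>F n in sequentially. 0 \<le> blinfun_apply f (x n)"
      using that x by (auto simp: dual_wedge_def)
    have "0 \<le> blinfun_apply f (y n - x n)" for n
      using that yx by (auto simp: dual_wedge_def)
    then show "\<forall>\<^sub>F n in sequentially. blinfun_apply f (x n) \<le> blinfun_apply f (y n)"
      by (simp add: blinfun.diff_right)
    show "(\<lambda>n. blinfun_apply f (y n)) \<longlonglongrightarrow> 0"
      using blinfun.tendsto[OF tendsto_const y0, of f] by simp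
  qed
  have span: "(\<lambda>n. blinfun_apply f (x n)) \<longlonglongrightarrow> 0" if "f \<in> span (dual_wedge P)" for f
    using that
  proof (induction rule: span_induct_alt)
    case base
    then show ?case by simp
  next
    case (step c g h)
    from tendsto_add[OF tendsto_mult_right_zero[OF pos[OF step(1)], of c] step(2)]
    show ?case by (simp add: blinfun.add_left blinfun.scaleR_left)
  qed
  have weak_x: "(\<lambda>n. blinfun_apply f (x n)) \<longlonglongrightarrow> 0" for f :: "'a \<Rightarrow>\<^sub>L real"
    by (rule bounded_weakly_null_if_dense[OF _ dense span, where K = 1]) (simp_all add: norm_x)

  define s where "s = (\<lambda>n. Y n + x n)"
  have s_step: "s (Suc n) - s n \<in> P" for n
    using cone(3)[OF yx[of n] x[of "Suc n"]] by (simp add: s_def Y_def algebra_simps)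
  have incr: "s m - s n \<in> P" if "n \<le> m" for n m
    using that
  proof (induction m rule: dec_induct)
    case base
    then show ?case using cone(2) by simp
  next
    case (step m)
    then show ?case
      using cone(3)[OF step.IH s_step[of m]] by simp
  qed
  have "s n \<in> P" for n
    using cone(3)[OF incr[of 0 n] x[of 0]] by (simp add: s_def Y_def)
  moreover have "increasing_seq P s"
    using incr by (simp add: increasing_seq_def cone_le_def)
  moreover have "weakly_convergent s"
    unfolding weakly_convergent_def
  proof (intro exI allI)
    fix f :: "'a \<Rightarrow>\<^sub>L real"
    have "(\<lambda>n. blinfun_apply f (Y n)) \<longlonglongrightarrow> blinfun_apply f (suminf y)"
      by (rule blinfun.tendsto[OF tendsto_const Y])
    from tendsto_add[OF this weak_x[of f]]
    show "(\<lambda>n. blinfun_apply f (s n)) \<longlonglongrightarrow> blinfun_apply f (suminf y)"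
      by (simp add: s_def blinfun.add_right)
  qed
  moreover have "\<not> convergent s"
  proof
    assume "convergent s"
    then obtain l where "s \<longlonglongrightarrow> l" unfolding convergent_def by blast
    from tendsto_diff[OF this Y] obtain z where z: "x \<longlonglongrightarrow> z"
      by (auto simp: s_def)
    have "norm z = 1"
      using LIMSEQ_unique[OF tendsto_norm[OF z]] norm_x by simp
    \<comment> \<open>The trivial wedge \<open>{0}\<close> is closed, so some functional is negative at the nonzero limit.\<close>
    then have "z \<notin> {0}" by auto
    then have "\<exists>f\<in>dual_wedge {0}. blinfun_apply f z < 0"
      by (intro closed_wedge_separation) auto
    then obtain f :: "'a \<Rightarrow>\<^sub>L real" where "blinfun_apply f z < 0" by blast
    moreover have "blinfun_apply f z = 0"
      using LIMSEQ_unique[OF blinfun.tendsto[OF tendsto_const z] weak_x[of f]] .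
    ultimately show False by simp
  qed
  ultimately show ?thesis by blast
qed

end
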